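(* There exist a function $\delta(n)\to 0$ and constants $C,a>0$ such that the following holds for every $n$. Consider $n$ agents and $m$ goods, where each agent $i$ has a submodular valuation normalized so that $\mathrm{MMS}_i=1$, and $v_i(\{e\})\le \frac1{12}$ for all $i\in[n]$, $e\in[m]$. If each agent follows the safe strategy to construct her buckets adaptively within the bucketing allocation algorithm, then with probability at least $1-Cn^{-a}$ every agent $i\in[n]$ simultaneously receives a bundle $A_i$ with $v_i(A_i)\ge\left(\frac1{12}-\delta(n)\right)\mathrm{MMS}_i$. (That is: a $\left(\frac{1}{12}-o(1)\right)$-approximation to MMS for all agents simultaneously with probability $1-1/\mathrm{poly}(n)$.)
   Context: Valuations $v_i:2^{[m]}\to\mathbb{R}_+$ are monotone; they are fixed in advance (oblivious adversary). The maximin share is $\mathrm{MMS}_i=\max_{(P_1,\dots,P_n)}\min_{\ell} v_i(P_\ell)$ over partitions of $[m]$ into $n$ bundles. Bucketing allocation algorithm (with adaptive buckets): set $R_1=[m]$. For $i=1,\dots,n$: agent $i$ observes the remaining set $R_i$ and partitions it into buckets $B_{i1},\dots,B_{i\ell_i}$ with $|B_{ij}|=3n$ for all $j\le \ell_i-1$; the buckets are specified one after another, and $B_{ij}$ may depend on the items drawn from the earlier buckets. From each $B_{ij}$, $j\le\ell_i-1$, one item is drawn uniformly at random, forming $A_{ij}$ (a singleton); nothing is drawn from $B_{i\ell_i}$. Agent $i$ is allocated $A_i=\bigcup_{j\le \ell_i-1}A_{ij}$, and $R_{i+1}=R_i\setminus A_i$. Safe strategy for a submodular agent $i$: let $\ell_i=\lceil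 |R_i|/3n\rceil$. For $j\in[\ell_i-1]$, $B_{ij}$ consists of the $3n$ elements of $R_i\setminus\bigcup_{j'<j}B_{ij'}$ with the highest marginal values $v_i(\cdot\mid\bigcup_{j'<j}A_{ij'})$ relative to the allocation so far, ties broken arbitrarily, where $v_i(e\mid X)=v_i(X\cup\{e\})-v_i(X)$. Finally $B_{i\ell_i}=R_i\setminus\bigcup_{j'<\ell_i}B_{ij'}$. *)

theory Defs
  imports "HOL-Probability.Probability"
begin

definition submodular_on :: "'a set \<Rightarrow> ('a set \<Rightarrow> real) \<Rightarrow> bool" where
  "submodular_on M v \<longleftrightarrow>
     (\<forall>S\<subseteq>M. \<forall>T\<subseteq>M. v (S \<union> T) + v (S \<inter> T) \<le> v S + v T)"

definition marginal :: "('a set \<Rightarrow> real) \<Rightarrow> 'a set \<Rightarrow> 'a \<Rightarrow> real" where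
  "marginal v X e = v (X \<union> {e}) - v X"

text \<open>Bundles of a partition are indexed by \<open>{..<n}\<close> and may be empty.\<close>

definition bundle_partitions :: "nat \<Rightarrow> 'a set \<Rightarrow> (nat \<Rightarrow> 'a set) set" where
  "bundle_partitions n M =
     {P. disjoint_family_on P {..<n} \<and> (\<Union>l<n. P l) = M}"

definition mms :: "nat \<Rightarrow> 'a set \<Rightarrow> ('a set \<Rightarrow> real) \<Rightarrow> real" where
  "mms n M v = (MAX P\<in>bundle_partitions n M. MIN l\<in>{..<n}. v (P l))"

text \<open>
  A plan \<open>(l, \<beta>)\<close> of a single agent consists of the number \<open>l\<close> of her buckets and a rule \<open>\<beta>\<close>
  for the buckets from which items are drawn: if the items drawn from her first \<open>j\<close> buckets
  are, in this order, the list \<open>ds\<close> of length \<open>j\<close>, then her next bucket is \<open>\<beta> ds\<close>.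
  Only the first \<open>l - 1\<close> buckets are given by \<open>\<beta>\<close>; the last one is what is left of the
  remaining goods, and nothing is drawn from it.
\<close>

type_synonym 'a plan = "nat \<times> ('a list \<Rightarrow> 'a set)"

text \<open>
  A history is the list of the sequences of items drawn by the agents so far, one sequence per
  agent.  The plan of agent \<open>i\<close> may depend on the whole history before her turn; since all
  earlier buckets are determined by the history, this makes the rule by which she
  resolves ties as general as possible.
\<close>

type_synonym 'a history = "'a list list"
type_synonym 'a strategies = "nat \<Rightarrow> 'a history \<Rightarrow> 'a plan"

definition remaining :: "'a set \<Rightarrow> 'a history \<Rightarrow> 'a set" where
  "remaining M H = M - (\<Union>ds\<in>set H. set ds)"

primrec draws :: "('a list \<Rightarrow> 'a set) \<Rightarrow> nat \<Rightarrow> 'a list pmf" where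
  "draws \<beta> 0 = return_pmf []"
| "draws \<beta> (Suc j) =
     bind_pmf (draws \<beta> j) (\<lambda>ds. map_pmf (\<lambda>e. ds @ [e]) (pmf_of_set (\<beta> ds)))"

text \<open>If \<open>l = 0\<close> (no goods remain), then \<open>l - 1\<close> is \<open>0\<close> and nothing is drawn.\<close>

definition agent_draws :: "'a plan \<Rightarrow> 'a list pmf" where
  "agent_draws p = draws (snd p) (fst p - 1)"

text \<open>The bucketing algorithm, up to and including the turns of the agents \<open>0, \<dots>, i - 1\<close>.\<close>

primrec bucketing :: "'a strategies \<Rightarrow> nat \<Rightarrow> 'a history pmf" where
  "bucketing \<sigma> 0 = return_pmf []"
| "bucketing \<sigma> (Suc i) =
     bind_pmf (bucketing \<sigma> i) (\<lambda>H. map_pmf (\<lambda>ds. H @ [ds]) (agent_draws (\<sigma> i H)))"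

definition allocated :: "'a history \<Rightarrow> nat \<Rightarrow> 'a set" where
  "allocated H i = set (H ! i)"

definition earlier_buckets :: "('a list \<Rightarrow> 'a set) \<Rightarrow> 'a list \<Rightarrow> 'a set" where
  "earlier_buckets \<beta> ds = (\<Union>k<length ds. \<beta> (take k ds))"

text \<open>\<open>B\<close> consists of \<open>k\<close> elements of \<open>S\<close> with the highest weights; ties may be broken
  in any way.\<close>

definition is_top :: "nat \<Rightarrow> ('a \<Rightarrow> real) \<Rightarrow> 'a set \<Rightarrow> 'a set \<Rightarrow> bool" where
  "is_top k w S B \<longleftrightarrow>
     B \<subseteq> S \<and> card B = k \<and> (\<forall>e\<in>B. \<forall>f\<in>S - B. w f \<le> w e)"

definition safe_plan :: "nat \<Rightarrow> ('a set \<Rightarrow> real) \<Rightarrow> 'a set \<Rightarrow> 'a plan \<Rightarrow> bool" where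
  "safe_plan n v R p \<longleftrightarrow>
     (let l = fst p; \<beta> = snd p in
        l = nat \<lceil>real (card R) / real (3 * n)\<rceil> \<and>
        (\<forall>j<l - 1. \<forall>ds\<in>set_pmf (draws \<beta> j).
           is_top (3 * n) (marginal v (set ds)) (R - earlier_buckets \<beta> ds) (\<beta> ds)))"

text \<open>Agent \<open>i\<close> follows the safe strategy after every history that can occur before her turn.\<close>

definition follows_safe_strategy ::
  "nat \<Rightarrow> 'a set \<Rightarrow> ('a set \<Rightarrow> real) \<Rightarrow> 'a strategies \<Rightarrow> nat \<Rightarrow> bool" where
  "follows_safe_strategy n M v \<sigma> i \<longleftrightarrow>
     (\<forall>H\<in>set_pmf (bucketing \<sigma> i). safe_plan n v (remaining M H) (\<sigma> i H))"

end

theory Submission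
  imports Defs
begin

text \<open>
  Fix an agent with valuation \<open>v\<close> and an optimal partition \<open>P\<close>.  Telescoping \<open>v\<close> along each
  bundle gives nonnegative weights \<open>w\<close> of total \<open>n\<close>, each at most \<open>1/12\<close>, whose sum over \<open>R\<close>
  is at most the sum of the \<open>v (P l \<inter> R)\<close>, for every set \<open>R\<close> of goods.

  In the safe strategy, every good outside the first bucket has, when its own bucket is formed, at
  most the marginal value of the good drawn from the preceding bucket.  Hence the marginal values of
  the goods of \<open>R\<close> over the final bundle \<open>A\<close> add up to at most \<open>3n (1/12 + v A)\<close>, while
  submodularity bounds this sum below by \<open>w R - n v A\<close>.  So \<open>v A < 1/12\<close> forces goods of weight
  more than \<open>5n/12\<close> to have been removed before the turn of the agent.  Each agent removes an
  expected weight of at most \<open>1/3\<close>, and an exponential moment bound with base \<open>5/4\<close> shows that this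
  has probability at most \<open>(e (4/5)\<^sup>5)\<^sup>n\<close>, which survives the union bound over the agents.
\<close>

section \<open>Monotone submodular functions\<close>

text \<open>For \<open>f\<close> outside \<open>Y\<close> this is submodularity for
  \<open>X \<union> {f}\<close> and \<open>Y\<close>. For \<open>f\<close> in \<open>Y\<close> the
  left side is 0 and monotonicity suffices.\<close>

lemma marginal_antimono:
  assumes "submodular_on M v" "mono_on (Pow M) v" "X \<subseteq> Y" "Y \<subseteq> M" "f \<in> M"
  shows "marginal v Y f \<le> marginal v X f"
proof (cases "f \<in> Y")
  case True
  have "v X \<le> v (X \<union> {f})"
    using assms by (intro mono_onD[OF assms(2)]) auto
  with True show ?thesis by (simp add: marginal_def insert_absorb)
next
  case False
  have "v ((X \<union> {f}) \<union> Y) + v ((X \<union> {f}) \<inter> Y) \<le> v (X \<union> {f}) + v Y"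
    using assms(1,3-5) unfolding submodular_on_def by (metis Un_subset_iff empty_subsetI insert_subset subset_trans)
  moreover have "(X \<union> {f}) \<union> Y = Y \<union> {f}" "(X \<union> {f}) \<inter> Y = X"
    using assms False by auto
  ultimately show ?thesis by (simp add: marginal_def)
qed

lemma marginal_nonneg:
  assumes "mono_on (Pow M) v" "X \<subseteq> M" "f \<in> M"
  shows "0 \<le> marginal v X f"
proof -
  have "v X \<le> v (X \<union> {f})"
    using assms by (intro mono_onD[OF assms(1)]) auto
  then show ?thesis by (simp add: marginal_def)
qed

text \<open>Add the goods of \<open>S\<close> to \<open>A\<close> one by one: each gain is taken
  over a superset of \<open>A\<close>, hence is at most the marginal value over
  \<open>A\<close>.\<close>

lemma le_sum_marginal:
  assumes sub: "submodular_on M v" and mono: "mono_on (Pow M) v"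
    and "A \<subseteq> M" "finite S" "S \<subseteq> M"
  shows "v (S \<union> A) \<le> v A + (\<Sum>f\<in>S. marginal v A f)"
  using \<open>finite S\<close> \<open>S \<subseteq> M\<close>
proof (induction S rule: finite_induct)
  case (insert x S)
  have "marginal v (S \<union> A) x \<le> marginal v A x"
    using insert.prems assms(3) by (intro marginal_antimono[OF sub mono]) auto
  with insert show ?case by (simp add: marginal_def)
qed simp

text \<open>This is the greedy vertex of the base polytope of \<open>v - v {}\<close>:
  \<open>u e\<close> is the marginal value of \<open>e\<close> over the goods inserted before it.
  The sum telescopes on \<open>S\<close>; on a subset \<open>T\<close> each good has fewer
  predecessors, so its marginal value can only grow.\<close>

lemma linear_minorant:
  assumes sub: "submodular_on M v" and mono: "mono_on (Pow M) v"
    and "finite S" "S \<subseteq> M"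
  shows "\<exists>u. (\<forall>e\<in>S. 0 \<le> u e \<and> u e \<le> marginal v {} e) \<and>
    v {} + (\<Sum>e\<in>S. u e) = v S \<and> (\<forall>T\<subseteq>S. v {} + (\<Sum>e\<in>T. u e) \<le> v T)"
  using \<open>finite S\<close> \<open>S \<subseteq> M\<close>
proof (induction S rule: finite_induct)
  case (insert x S)
  then obtain u where u: "\<And>e. e \<in> S \<Longrightarrow> 0 \<le> u e \<and> u e \<le> marginal v {} e"
    "v {} + (\<Sum>e\<in>S. u e) = v S" "\<And>T. T \<subseteq> S \<Longrightarrow> v {} + (\<Sum>e\<in>T. u e) \<le> v T"
    by auto
  define u' where "u' = u(x := marginal v S x)"
  have u'_sum: "(\<Sum>e\<in>T. u' e) = (\<Sum>e\<in>T. u e)" if "T \<subseteq> S" for T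
    using that insert.hyps by (intro sum.cong) (auto simp: u'_def)
  have "\<forall>e\<in>insert x S. 0 \<le> u' e \<and> u' e \<le> marginal v {} e"
    using u(1) insert.prems marginal_nonneg[OF mono, of S x]
      marginal_antimono[OF sub mono, of "{}" S x]
    by (auto simp: u'_def)
  moreover have "v {} + (\<Sum>e\<in>insert x S. u' e) = v (insert x S)"
    using insert.hyps u(2) u'_sum[of S] by (simp add: u'_def marginal_def)
  moreover have "v {} + (\<Sum>e\<in>T. u' e) \<le> v T" if T: "T \<subseteq> insert x S" for T
  proof (cases "x \<in> T")
    case True
    define T' where "T' = T - {x}"
    have T': "T' \<subseteq> S" "x \<notin> T'" "T = insert x T'" using True T by (auto simp: T'_def)
    then have "marginal v S x \<le> marginal v T' x"
      using insert.prems by (intro marginal_antimono[OF sub mono]) auto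
    moreover have "finite T'" using T'(1) insert.hyps finite_subset by blast
    ultimately show ?thesis
      using T' u(3)[OF T'(1)] u'_sum[OF T'(1)] by (simp add: marginal_def u'_def)
  next
    case False
    then have "T \<subseteq> S" using T by auto
    then show ?thesis using u(3) u'_sum by simp
  qed
  ultimately show ?case by blast
qed auto

section \<open>Maximin partitions and the weights derived from them\<close>

lemma mms_attained:
  assumes "n \<ge> 1" "finite M"
  shows "\<exists>P\<in>bundle_partitions n M. \<forall>l<n. mms n M v \<le> v (P l)"
proof -
  define F where "F = (\<lambda>P. MIN l\<in>{..<n}. v (P l))"
  have ne: "{..<n} \<noteq> {}" using assms(1) by (auto simp: lessThan_empty_iff)
  have "F ` bundle_partitions n M \<subseteq> v ` Pow M"
  proof
    fix y assume "y \<in> F ` bundle_partitions n M"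
    then obtain P where P: "P \<in> bundle_partitions n M" "y = F P" by auto
    have "F P \<in> (\<lambda>l. v (P l)) ` {..<n}"
      unfolding F_def using ne by (intro Min_in) auto
    with P show "y \<in> v ` Pow M" by (auto simp: bundle_partitions_def)
  qed
  then have fin: "finite (F ` bundle_partitions n M)"
    using assms(2) by (meson finite_Pow_iff finite_imageI finite_subset)
  have "(\<lambda>l. if l = 0 then M else {}) \<in> bundle_partitions n M"
    using assms(1) by (auto simp: bundle_partitions_def disjoint_family_on_def split: if_splits)
  then have "F ` bundle_partitions n M \<noteq> {}" by auto
  from Max_in[OF fin this] obtain P where P: "P \<in> bundle_partitions n M" "mms n M v = F P"
    unfolding mms_def F_def by auto
  have "F P \<le> v (P l)" if "l < n" for l
    unfolding F_def using that by (intro Min_le) auto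
  with P show ?thesis by auto
qed

text \<open>Each bundle gets the weights of \<open>linear_minorant\<close>, rescaled to total
  exactly 1. The rescaling has to absorb \<open>v {}\<close>, which may be positive.\<close>

lemma partition_weights:
  fixes t :: real
  assumes sub: "submodular_on M v" and mono: "mono_on (Pow M) v" and fin: "finite M"
    and nonneg: "0 \<le> v {}" and lt: "v {} < 1" and small: "\<And>e. e \<in> M \<Longrightarrow> v {e} \<le> t" and t: "t \<le> 1"
    and P: "P \<in> bundle_partitions n M" and ge: "\<And>l. l < n \<Longrightarrow> 1 \<le> v (P l)"
  shows "\<exists>w. (\<forall>e\<in>M. 0 \<le> w e \<and> w e \<le> t) \<and> (\<Sum>e\<in>M. w e) = real n \<and>
    (\<forall>R\<subseteq>M. (\<Sum>e\<in>R. w e) \<le> (\<Sum>l<n. v (P l \<inter> R)))"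
proof -
  have disj: "\<And>k l. k < n \<Longrightarrow> l < n \<Longrightarrow> k \<noteq> l \<Longrightarrow> P k \<inter> P l = {}" and un: "(\<Union>l<n. P l) = M"
    using P by (auto simp: bundle_partitions_def disjoint_family_on_def)
  have "\<exists>u. (\<forall>e\<in>P l. 0 \<le> u e \<and> u e \<le> t) \<and> (\<Sum>e\<in>P l. u e) = 1 \<and>
      (\<forall>T\<subseteq>P l. (\<Sum>e\<in>T. u e) \<le> v T)" if l: "l < n" for l
  proof -
    have PM: "P l \<subseteq> M" using un l by auto
    obtain u where u: "\<And>e. e \<in> P l \<Longrightarrow> 0 \<le> u e \<and> u e \<le> marginal v {} e"
      "v {} + (\<Sum>e\<in>P l. u e) = v (P l)" "\<And>T. T \<subseteq> P l \<Longrightarrow> v {} + (\<Sum>e\<in>T. u e) \<le> v T"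
      using linear_minorant[OF sub mono finite_subset[OF PM fin] PM] by auto
    define W where "W = v (P l) - v {}"
    have W: "1 - v {} \<le> W" "0 < W" using ge[OF l] lt by (auto simp: W_def)
    have "0 \<le> u e / W \<and> u e / W \<le> t" if "e \<in> P l" for e
    proof -
      have "u e \<le> t - v {}" using u(1)[OF that] small[of e] that PM by (auto simp: marginal_def)
      moreover have "v {} \<le> v {e}" using that PM by (intro mono_onD[OF mono]) auto
      then have t0: "0 \<le> t" using small[of e] that PM nonneg by force
      \<comment> \<open>The singleton bound leaves slack \<open>v {}\<close>, which pays for
        dividing by a \<open>W\<close> that may be as small as \<open>1 - v {}\<close>; this is
        where \<open>t \<le> 1\<close> enters.\<close>
      have "t - v {} \<le> t * (1 - v {})"
        using mult_right_mono[OF t nonneg] by (simp add: algebra_simps)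
      moreover have "t * (1 - v {}) \<le> t * W"
        using W t0 by (intro mult_left_mono)
      ultimately show ?thesis
        using u(1)[OF that] W by (auto simp: divide_simps)
    qed
    moreover have "(\<Sum>e\<in>P l. u e / W) = 1"
      using u(2) W by (simp add: sum_divide_distrib[symmetric] W_def)
    moreover have "(\<Sum>e\<in>T. u e / W) \<le> v T" if T: "T \<subseteq> P l" for T
    proof -
      define s where "s = (\<Sum>e\<in>T. u e)"
      have "0 \<le> s" unfolding s_def using T u(1) by (intro sum_nonneg) auto
      have "s \<le> (\<Sum>e\<in>P l. u e)" unfolding s_def using T u(1) finite_subset[OF PM fin]
        by (intro sum_mono2) auto
      then have "s \<le> W" using u(2) by (simp add: W_def)
      \<comment> \<open>Rescaling raises the sum over \<open>T\<close> by at most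
        \<open>v {}\<close>, exactly the slack in the minorant inequality for
        \<open>T\<close>.\<close>
      have "s / W - s \<le> v {}"
      proof -
        have "s * (1 - W) \<le> W * v {}"
        proof (cases "1 - W \<ge> 0")
          case True
          then have "s * (1 - W) \<le> W * (1 - W)"
            using \<open>s \<le> W\<close> by (intro mult_right_mono)
          also have "\<dots> \<le> W * v {}" using W by (intro mult_left_mono) auto
          finally show ?thesis .
        next
          case False
          then have "s * (1 - W) \<le> 0" using \<open>0 \<le> s\<close> by (intro mult_nonneg_nonpos) auto
          also have "0 \<le> W * v {}" using W nonneg by simp
          finally show ?thesis .
        qed
        then show ?thesis using W by (simp add: field_simps)
      qed
      then show ?thesis using u(3)[OF T] by (simp add: sum_divide_distrib[symmetric] s_def)
    qed
    ultimately show ?thesis by (intro exI[of _ "\<lambda>e. u e / W"]) auto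
  qed
  then obtain u where u: "\<And>l e. l < n \<Longrightarrow> e \<in> P l \<Longrightarrow> 0 \<le> u l e \<and> u l e \<le> t"
    "\<And>l. l < n \<Longrightarrow> (\<Sum>e\<in>P l. u l e) = 1"
    "\<And>l T. l < n \<Longrightarrow> T \<subseteq> P l \<Longrightarrow> (\<Sum>e\<in>T. u l e) \<le> v T"
    by metis
  define w where "w e = (\<Sum>l<n. if e \<in> P l then u l e else 0)" for e
  have w_eq: "w e = u l e" if "l < n" "e \<in> P l" for l e
  proof -
    have "w e = (\<Sum>k<n. if k = l then u l e else 0)"
      unfolding w_def using that disj by (intro sum.cong) auto
    then show ?thesis using that by simp
  qed
  have w_sum: "(\<Sum>e\<in>R. w e) = (\<Sum>l<n. \<Sum>e\<in>P l \<inter> R. u l e)" if "R \<subseteq> M" for R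
  proof -
    have "finite R" using that fin finite_subset by blast
    have "(\<Sum>e\<in>R. w e) = (\<Sum>l<n. \<Sum>e\<in>R. if e \<in> P l then u l e else 0)"
      unfolding w_def by (rule sum.swap)
    also have "\<dots> = (\<Sum>l<n. \<Sum>e\<in>P l \<inter> R. u l e)"
      by (simp add: sum.inter_restrict[OF \<open>finite R\<close>, symmetric] Int_commute)
    finally show ?thesis .
  qed
  have "\<forall>e\<in>M. 0 \<le> w e \<and> w e \<le> t" using u(1) un w_eq by fastforce
  moreover have "(\<Sum>e\<in>M. w e) = real n"
  proof -
    have "P l \<inter> M = P l" if "l < n" for l using that un by auto
    then show ?thesis using u(2) by (simp add: w_sum)
  qed
  moreover have "(\<Sum>e\<in>R. w e) \<le> (\<Sum>l<n. v (P l \<inter> R))" if "R \<subseteq> M" for R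
    unfolding w_sum[OF that] using u(3) by (intro sum_mono) auto
  ultimately show ?thesis by blast
qed

section \<open>The turn of one agent\<close>

lemma length_draws: "ds \<in> set_pmf (draws \<beta> j) \<Longrightarrow> length ds = j"
  by (induction j arbitrary: ds) auto

lemma earlier_buckets_Nil [simp]: "earlier_buckets \<beta> [] = {}"
  by (simp add: earlier_buckets_def)

lemma earlier_buckets_snoc [simp]:
  "earlier_buckets \<beta> (ds @ [e]) = earlier_buckets \<beta> ds \<union> \<beta> ds"
  by (auto simp: earlier_buckets_def lessThan_Suc)

text \<open>Retains from the safe strategy only what does not involve a valuation, so that weights
  derived from one agent can be tracked through the turns of all the others.\<close>

definition valid_buckets :: "nat \<Rightarrow> 'a set \<Rightarrow> ('a list \<Rightarrow> 'a set) \<Rightarrow> nat \<Rightarrow> bool" where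
  "valid_buckets k R \<beta> l \<longleftrightarrow>
     (\<forall>j<l. \<forall>ds\<in>set_pmf (draws \<beta> j). \<beta> ds \<subseteq> R - earlier_buckets \<beta> ds \<and> card (\<beta> ds) = k)"

lemma safe_plan_valid_buckets:
  "safe_plan n v R p \<Longrightarrow> valid_buckets (3 * n) R (snd p) (fst p - 1)"
  by (auto simp: safe_plan_def valid_buckets_def is_top_def Let_def)

lemma set_pmf_draws_Suc:
  assumes "valid_buckets k R \<beta> l" "0 < k" "j < l" "xs \<in> set_pmf (draws \<beta> (Suc j))"
  obtains ds e where "xs = ds @ [e]" "ds \<in> set_pmf (draws \<beta> j)" "e \<in> \<beta> ds"
    "\<beta> ds \<subseteq> R - earlier_buckets \<beta> ds" "card (\<beta> ds) = k"
proof -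
  obtain ds e where *: "xs = ds @ [e]" "ds \<in> set_pmf (draws \<beta> j)" "e \<in> set_pmf (pmf_of_set (\<beta> ds))"
    using assms(4) by auto
  have B: "\<beta> ds \<subseteq> R - earlier_buckets \<beta> ds" "card (\<beta> ds) = k"
    using assms(1,3) *(2) by (auto simp: valid_buckets_def)
  \<comment> \<open>Infinite sets have \<open>card\<close> 0, so positive cardinality gives both
    conditions under which \<open>pmf_of_set\<close> is the uniform distribution.\<close>
  have "finite (\<beta> ds)" "\<beta> ds \<noteq> {}" using B(2) \<open>0 < k\<close> card_gt_0_iff[of "\<beta> ds"] by auto
  then show ?thesis using * B that by (simp add: set_pmf_of_set)
qed

lemma draws_buckets:
  assumes "valid_buckets k R \<beta> l" "0 < k" "finite R" "j \<le> l" "ds \<in> set_pmf (draws \<beta> j)"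
  shows "set ds \<subseteq> earlier_buckets \<beta> ds \<and> earlier_buckets \<beta> ds \<subseteq> R \<and>
    card (earlier_buckets \<beta> ds) = k * j"
  using assms(4,5)
proof (induction j arbitrary: ds)
  case (Suc j)
  obtain ds' e where *: "ds = ds' @ [e]" "ds' \<in> set_pmf (draws \<beta> j)" "e \<in> \<beta> ds'"
    "\<beta> ds' \<subseteq> R - earlier_buckets \<beta> ds'" "card (\<beta> ds') = k"
    by (rule set_pmf_draws_Suc[OF assms(1,2) _ Suc.prems(2)]) (use Suc.prems in auto)
  have IH: "set ds' \<subseteq> earlier_buckets \<beta> ds'" "earlier_buckets \<beta> ds' \<subseteq> R"
    "card (earlier_buckets \<beta> ds') = k * j"
    using Suc.IH[OF _ *(2)] Suc.prems by auto
  have "card (earlier_buckets \<beta> ds' \<union> \<beta> ds') = k * j + k"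
    using IH * assms(3) by (subst card_Un_disjoint) (auto intro: finite_subset)
  with IH * show ?case by auto
qed simp

lemma safe_plan_set_draws:
  assumes "safe_plan n v R p" "n \<ge> 1" "finite R" "ds \<in> set_pmf (agent_draws p)"
  shows "set ds \<subseteq> R"
  using draws_buckets[OF safe_plan_valid_buckets[OF assms(1)] _ assms(3) order_refl, of ds] assms
  by (auto simp: agent_draws_def)

text \<open>An amortized count: the first bucket is charged to \<open>t\<close>, every later one,
  including the last, to the draw just before it. The gains of the draws telescope to at most
  \<open>v (set ds)\<close>, and each is charged by at most \<open>3n\<close> goods.\<close>

lemma safe_plan_sum_marginal_le:
  fixes t :: real
  assumes sub: "submodular_on M v" and mono: "mono_on (Pow M) v" and fin: "finite M"
    and nonneg: "0 \<le> v {}" and small: "\<And>e. e \<in> M \<Longrightarrow> v {e} \<le> t" and t: "0 \<le> t"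
    and "n \<ge> 1" and R: "R \<subseteq> M" and safe: "safe_plan n v R p"
    and ds: "ds \<in> set_pmf (agent_draws p)"
  shows "(\<Sum>f\<in>R. marginal v (set ds) f) \<le> 3 * real n * (t + v (set ds))"
proof -
  obtain l \<beta> where p: "p = (l, \<beta>)" by fastforce
  have finR: "finite R" using fin R finite_subset by blast
  have l: "l = nat \<lceil>real (card R) / real (3 * n)\<rceil>"
    and top: "\<And>j ds. j < l - 1 \<Longrightarrow> ds \<in> set_pmf (draws \<beta> j) \<Longrightarrow>
      is_top (3 * n) (marginal v (set ds)) (R - earlier_buckets \<beta> ds) (\<beta> ds)"
    using safe by (auto simp: safe_plan_def p Let_def)
  have valid: "valid_buckets (3 * n) R \<beta> (l - 1)"
    using safe_plan_valid_buckets[OF safe] by (simp add: p)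
  note buckets = draws_buckets[OF valid _ finR]
  \<comment> \<open>\<open>\<tau>\<close> is the marginal value of the latest good drawn: the bucket formed next will cost at
    most \<open>3n \<tau>\<close>, which is paid for by the gain in \<open>v\<close> from that draw.\<close>
  have invar: "\<exists>\<tau>\<ge>0. (\<forall>f\<in>R - earlier_buckets \<beta> ds. marginal v (set ds) f \<le> \<tau>) \<and>
      (\<Sum>f\<in>earlier_buckets \<beta> ds. marginal v (set ds) f) + 3 * real n * \<tau>
        \<le> 3 * real n * (t + v (set ds))"
    if "j \<le> l - 1" "ds \<in> set_pmf (draws \<beta> j)" for j ds
    using that
  proof (induction j arbitrary: ds)
    case 0
    have "marginal v {} f \<le> t" if "f \<in> R" for f
      using small[of f] nonneg that R by (auto simp: marginal_def)
    with 0 show ?case using t nonneg \<open>n \<ge> 1\<close> by (intro exI[of _ t]) auto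
  next
    case (Suc j)
    have j: "j < l - 1" using Suc.prems by auto
    obtain ds' e where *: "ds = ds' @ [e]" "ds' \<in> set_pmf (draws \<beta> j)" "e \<in> \<beta> ds'"
      "\<beta> ds' \<subseteq> R - earlier_buckets \<beta> ds'" "card (\<beta> ds') = 3 * n"
      by (rule set_pmf_draws_Suc[OF valid _ j Suc.prems(2)]) (use \<open>n \<ge> 1\<close> in auto)
    define E B where "E = earlier_buckets \<beta> ds'" and "B = \<beta> ds'"
    have E: "set ds' \<subseteq> E" "E \<subseteq> R"
      using buckets[OF _ _ *(2)] j \<open>n \<ge> 1\<close> by (auto simp: E_def)
    have B: "e \<in> B" "B \<subseteq> R - E" "card B = 3 * n" using * by (auto simp: B_def E_def)
    obtain \<tau> where \<tau>: "\<tau> \<ge> 0" "\<And>f. f \<in> R - E \<Longrightarrow> marginal v (set ds') f \<le> \<tau>"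
      "(\<Sum>f\<in>E. marginal v (set ds') f) + 3 * real n * \<tau> \<le> 3 * real n * (t + v (set ds'))"
      using Suc.IH[OF _ *(2)] j by (auto simp: E_def)
    define \<tau>' where "\<tau>' = marginal v (set ds') e"
    have e: "e \<in> M" "set ds' \<subseteq> M" using B E R by auto
    have anti: "marginal v (set ds) f \<le> marginal v (set ds') f" if "f \<in> R" for f
      using that R e *(1) by (intro marginal_antimono[OF sub mono]) auto
    have "0 \<le> \<tau>'" unfolding \<tau>'_def using e by (intro marginal_nonneg[OF mono])
    moreover have "marginal v (set ds) f \<le> \<tau>'" if "f \<in> R - (E \<union> B)" for f
    proof -
      \<comment> \<open>The drawn good \<open>e\<close> is among the top \<open>3n\<close>, so
        whichever good was drawn, it dominates everything left outside the bucket.\<close>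
      have "marginal v (set ds') f \<le> \<tau>'"
        using top[OF j *(2)] that B(1) unfolding is_top_def \<tau>'_def E_def B_def by auto
      with anti[of f] that show ?thesis by auto
    qed
    moreover have "(\<Sum>f\<in>E \<union> B. marginal v (set ds) f) + 3 * real n * \<tau>'
        \<le> 3 * real n * (t + v (set ds))"
    proof -
      have "(\<Sum>f\<in>E \<union> B. marginal v (set ds) f) \<le> (\<Sum>f\<in>E \<union> B. marginal v (set ds') f)"
        using E B anti by (intro sum_mono) auto
      also have "\<dots> = (\<Sum>f\<in>E. marginal v (set ds') f) + (\<Sum>f\<in>B. marginal v (set ds') f)"
        using E B finR by (intro sum.union_disjoint) (auto intro: finite_subset)
      also have "(\<Sum>f\<in>B. marginal v (set ds') f) \<le> real (card B) * \<tau>"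
        using B \<tau>(2) by (intro sum_bounded_above) auto
      finally have "(\<Sum>f\<in>E \<union> B. marginal v (set ds) f) \<le> 3 * real n * (t + v (set ds'))"
        using \<tau>(3) B(3) by simp
      moreover have "v (set ds) = v (set ds') + \<tau>'" by (simp add: \<tau>'_def marginal_def *(1))
      ultimately show ?thesis by (simp add: algebra_simps)
    qed
    moreover have "earlier_buckets \<beta> ds = E \<union> B" by (simp add: *(1) E_def B_def)
    ultimately show ?case by auto
  qed
  define E where "E = earlier_buckets \<beta> ds"
  have ds': "ds \<in> set_pmf (draws \<beta> (l - 1))" using ds by (simp add: agent_draws_def p)
  have E: "set ds \<subseteq> E" "E \<subseteq> R" "card E = 3 * n * (l - 1)"
    using buckets[OF _ order_refl ds'] \<open>n \<ge> 1\<close> by (auto simp: E_def)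
  obtain \<tau> where \<tau>: "\<tau> \<ge> 0" "\<And>f. f \<in> R - E \<Longrightarrow> marginal v (set ds) f \<le> \<tau>"
    "(\<Sum>f\<in>E. marginal v (set ds) f) + 3 * real n * \<tau> \<le> 3 * real n * (t + v (set ds))"
    using invar[OF order_refl ds'] by (auto simp: E_def)
  have "real (card R) / real (3 * n) \<le> real l" unfolding l by linarith
  then have "real (card R) \<le> real (3 * n * l)" using \<open>n \<ge> 1\<close> by (simp add: field_simps)
  then have "card R \<le> 3 * n * l" by linarith
  \<comment> \<open>The ceiling leaves at most \<open>3n\<close> goods for the last bucket.
    Truncated subtraction makes this an inequality when \<open>l = 0\<close>.\<close>
  also have "\<dots> \<le> 3 * n * (l - 1) + 3 * n" by (cases l) auto
  finally have "card (R - E) \<le> 3 * n"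
    using E finR by (subst card_Diff_subset) (auto intro: finite_subset)
  have "(\<Sum>f\<in>R. marginal v (set ds) f)
      = (\<Sum>f\<in>E. marginal v (set ds) f) + (\<Sum>f\<in>R - E. marginal v (set ds) f)"
    using sum.subset_diff[OF E(2) finR, of "marginal v (set ds)"] by simp
  also have "(\<Sum>f\<in>R - E. marginal v (set ds) f) \<le> real (card (R - E)) * \<tau>"
    using \<tau>(2) by (intro sum_bounded_above)
  also have "\<dots> \<le> real (3 * n) * \<tau>"
    using \<open>card (R - E) \<le> 3 * n\<close> \<tau>(1) by (intro mult_right_mono) auto
  finally show ?thesis using \<tau>(3) by simp
qed

text \<open>Each of the \<open>n\<close> bundles costs one \<open>v (set ds)\<close> plus its
  marginal values, and the latter total at most \<open>3n (t + v (set ds))\<close>. Read backwards,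
  this bounds the agent's value from below.\<close>

lemma safe_plan_value_ge:
  fixes t :: real
  assumes sub: "submodular_on M v" and mono: "mono_on (Pow M) v" and fin: "finite M"
    and nonneg: "0 \<le> v {}" and small: "\<And>e. e \<in> M \<Longrightarrow> v {e} \<le> t" and t: "0 \<le> t"
    and n: "n \<ge> 1" and R: "R \<subseteq> M" and safe: "safe_plan n v R p"
    and ds: "ds \<in> set_pmf (agent_draws p)" and P: "P \<in> bundle_partitions n M"
  shows "(\<Sum>l<n. v (P l \<inter> R)) \<le> real n * (3 * t + 4 * v (set ds))"
proof -
  have un: "(\<Union>l<n. P l) = M" and disj: "disjoint_family_on P {..<n}"
    using P by (auto simp: bundle_partitions_def)
  have finR: "finite R" using fin R finite_subset by blast
  have A: "set ds \<subseteq> M" using safe_plan_set_draws[OF safe n finR ds] R by auto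
  have "v (P l \<inter> R) \<le> v (set ds) + (\<Sum>f\<in>P l \<inter> R. marginal v (set ds) f)" for l
  proof -
    have "v (P l \<inter> R) \<le> v ((P l \<inter> R) \<union> set ds)"
      using A R by (intro mono_onD[OF mono]) auto
    also have "\<dots> \<le> v (set ds) + (\<Sum>f\<in>P l \<inter> R. marginal v (set ds) f)"
      using A R finR by (intro le_sum_marginal[OF sub mono]) auto
    finally show ?thesis .
  qed
  then have "(\<Sum>l<n. v (P l \<inter> R))
      \<le> (\<Sum>l<n. v (set ds) + (\<Sum>f\<in>P l \<inter> R. marginal v (set ds) f))"
    by (intro sum_mono)
  also have "\<dots> = real n * v (set ds) + (\<Sum>l<n. \<Sum>f\<in>P l \<inter> R. marginal v (set ds) f)"
    by (simp add: sum.distrib)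
  also have "(\<Sum>l<n. \<Sum>f\<in>P l \<inter> R. marginal v (set ds) f)
      = (\<Sum>f\<in>(\<Union>l<n. P l \<inter> R). marginal v (set ds) f)"
    using disj finR by (subst sum.UNION_disjoint) (auto simp: disjoint_family_on_def)
  also have "(\<Union>l<n. P l \<inter> R) = R" using un R by auto
  also have "(\<Sum>f\<in>R. marginal v (set ds) f) \<le> 3 * real n * (t + v (set ds))"
    using safe_plan_sum_marginal_le[OF sub mono fin nonneg small t n R safe ds] .
  finally show ?thesis by (simp add: algebra_simps)
qed

section \<open>The weight of the removed goods\<close>

text \<open>Here \<open>c\<close> is the reciprocal of the maximal weight and \<open>1 + r\<close> the base of the exponential moment.\<close>

definition weight_potential :: "real \<Rightarrow> real \<Rightarrow> ('a \<Rightarrow> real) \<Rightarrow> 'a list \<Rightarrow> real" where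
  "weight_potential r c w ds = (1 + r) powr (c * sum_list (map w ds))"

text \<open>The chord of the convex exponential between the exponents 0 and 1.\<close>

lemma powr_le_linear:
  fixes r x :: real
  assumes "0 \<le> r" "0 \<le> x" "x \<le> 1"
  shows "(1 + r) powr x \<le> 1 + r * x"
proof -
  have "exp ((1 - x) *\<^sub>R 0 + x *\<^sub>R ln (1 + r)) \<le> (1 - x) * exp 0 + x * exp (ln (1 + r))"
    using assms by (intro convex_onD[OF exp_convex]) auto
  with assms show ?thesis by (simp add: powr_def algebra_simps)
qed

text \<open>Adaptive buckets make the conditional mean weight of a draw random. The exponential
  factor compensates for the weight of the buckets formed so far, divided by \<open>k\<close>, and
  turns the potential into a supermartingale that starts at 1.\<close>

lemma draws_potential:
  assumes valid: "valid_buckets k R \<beta> l" and k: "0 < k" and fin: "finite R"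
    and w: "\<And>e. e \<in> R \<Longrightarrow> 0 \<le> w e \<and> c * w e \<le> 1" and r: "0 \<le> r" and c: "0 \<le> c"
    and j: "j \<le> l"
  shows "(\<integral>\<^sup>+ds. ennreal (weight_potential r c w ds *
    exp (- (r * c / k * (\<Sum>e\<in>earlier_buckets \<beta> ds. w e)))) \<partial>draws \<beta> j) \<le> 1"
  using j
proof (induction j)
  case 0
  show ?case by (simp add: weight_potential_def)
next
  case (Suc j)
  define F where "F ds = weight_potential r c w ds *
    exp (- (r * c / k * (\<Sum>e\<in>earlier_buckets \<beta> ds. w e)))" for ds
  have F_nonneg: "0 \<le> F ds" for ds by (simp add: F_def weight_potential_def)
  have step: "(\<integral>\<^sup>+e. ennreal (F (ds @ [e])) \<partial>pmf_of_set (\<beta> ds)) \<le> ennreal (F ds)"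
    if ds: "ds \<in> set_pmf (draws \<beta> j)" for ds
  proof -
    define B where "B = \<beta> ds"
    have B: "B \<subseteq> R - earlier_buckets \<beta> ds" "card B = k"
      using valid ds Suc_le_lessD[OF Suc.prems] by (auto simp: valid_buckets_def B_def)
    have finB: "finite B" "B \<noteq> {}" using B(2) k card_gt_0_iff[of B] by auto
    have ER: "earlier_buckets \<beta> ds \<subseteq> R"
      using draws_buckets[OF valid k fin _ ds] Suc.prems by auto
    define wB where "wB = (\<Sum>e\<in>B. w e)"
    have F_snoc: "F (ds @ [e]) = F ds * ((1 + r) powr (c * w e) * exp (- (r * c / k * wB)))" for e
    proof -
      have "(\<Sum>e\<in>earlier_buckets \<beta> ds \<union> \<beta> ds. w e) = (\<Sum>e\<in>earlier_buckets \<beta> ds. w e) + wB"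
        unfolding wB_def B_def[symmetric] using B ER fin finB
        by (intro sum.union_disjoint) (auto intro: finite_subset)
      then show ?thesis
        by (simp add: F_def weight_potential_def powr_add algebra_simps flip: exp_add)
    qed
    have "(\<Sum>e\<in>B. (1 + r) powr (c * w e)) \<le> (\<Sum>e\<in>B. 1 + r * (c * w e))"
      using B w r c by (intro sum_mono powr_le_linear) auto
    also have "\<dots> = k * (1 + r * c / k * wB)"
      using k B(2) by (simp add: sum.distrib wB_def sum_distrib_left field_simps)
    \<comment> \<open>This is the compensator of the new bucket, so averaging over its draw cancels
      it.\<close>
    also have "\<dots> \<le> k * exp (r * c / k * wB)"
      by (intro mult_left_mono exp_ge_add_one_self) auto
    finally have avg: "(\<Sum>e\<in>B. (1 + r) powr (c * w e)) \<le> k * exp (r * c / k * wB)" .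
    have "(\<integral>\<^sup>+e. ennreal (F (ds @ [e])) \<partial>pmf_of_set (\<beta> ds))
        = (\<Sum>e\<in>B. ennreal (F (ds @ [e]))) / ennreal k"
      using finB B(2) by (simp add: nn_integral_pmf_of_set B_def[symmetric] ennreal_of_nat_eq_real_of_nat)
    also have "\<dots> = ennreal ((\<Sum>e\<in>B. F (ds @ [e])) / k)"
      using F_nonneg k by (simp add: sum_ennreal divide_ennreal sum_nonneg)
    also have "(\<Sum>e\<in>B. F (ds @ [e])) / k
        = F ds * exp (- (r * c / k * wB)) / k * (\<Sum>e\<in>B. (1 + r) powr (c * w e))"
      by (simp add: F_snoc sum_distrib_left sum_divide_distrib mult_ac)
    also have "ennreal \<dots> \<le> ennreal (F ds)"
    proof (rule ennreal_leI)
      have "F ds * exp (- (r * c / k * wB)) / k * (\<Sum>e\<in>B. (1 + r) powr (c * w e))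
          \<le> F ds * exp (- (r * c / k * wB)) / k * (k * exp (r * c / k * wB))"
        using avg F_nonneg[of ds] by (intro mult_left_mono) auto
      also have "\<dots> = F ds" using k by (simp add: exp_minus field_simps)
      finally show "F ds * exp (- (r * c / k * wB)) / k * (\<Sum>e\<in>B. (1 + r) powr (c * w e)) \<le> F ds" .
    qed
    finally show ?thesis .
  qed
  have "(\<integral>\<^sup>+ds. ennreal (F ds) \<partial>draws \<beta> (Suc j))
      = (\<integral>\<^sup>+ds. \<integral>\<^sup>+e. ennreal (F (ds @ [e])) \<partial>pmf_of_set (\<beta> ds) \<partial>draws \<beta> j)"
    by simp
  also have "\<dots> \<le> (\<integral>\<^sup>+ds. ennreal (F ds) \<partial>draws \<beta> j)"
    using step by (intro nn_integral_mono_AE) (auto simp: AE_measure_pmf_iff)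
  also have "\<dots> \<le> 1" using Suc by (simp add: F_def)
  finally show ?case by (simp add: F_def)
qed

text \<open>The buckets together weigh at most \<open>n\<close>, whatever is drawn, so with
  \<open>k = 3n\<close> the compensator is at least \<open>exp (- (r * c / 3))\<close> and can be
  removed.\<close>

lemma agent_draws_potential:
  assumes safe: "safe_plan n v R p" and n: "n \<ge> 1" and fin: "finite R"
    and w: "\<And>e. e \<in> R \<Longrightarrow> 0 \<le> w e \<and> c * w e \<le> 1" and r: "0 \<le> r" and c: "0 \<le> c"
    and le: "(\<Sum>e\<in>R. w e) \<le> real n"
  shows "(\<integral>\<^sup>+ds. ennreal (weight_potential r c w ds) \<partial>agent_draws p) \<le> ennreal (exp (r * c / 3))"
proof -
  obtain l \<beta> where p: "p = (l, \<beta>)" by fastforce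
  have valid: "valid_buckets (3 * n) R \<beta> (l - 1)"
    using safe_plan_valid_buckets[OF safe] by (simp add: p)
  have k: "0 < 3 * n" using n by simp
  define G where "G ds = weight_potential r c w ds *
    exp (- (r * c / (3 * n) * (\<Sum>e\<in>earlier_buckets \<beta> ds. w e)))" for ds
  have "weight_potential r c w ds \<le> exp (r * c / 3) * G ds"
    if ds: "ds \<in> set_pmf (draws \<beta> (l - 1))" for ds
  proof -
    have "earlier_buckets \<beta> ds \<subseteq> R"
      using draws_buckets[OF valid k fin order_refl ds] by auto
    then have "(\<Sum>e\<in>earlier_buckets \<beta> ds. w e) \<le> (\<Sum>e\<in>R. w e)"
      using w fin by (intro sum_mono2) auto
    with le have "(\<Sum>e\<in>earlier_buckets \<beta> ds. w e) \<le> real n" by simp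
    then have "r * c / (3 * n) * (\<Sum>e\<in>earlier_buckets \<beta> ds. w e) \<le> r * c / (3 * n) * real n"
      using r c by (intro mult_left_mono) auto
    also have "\<dots> = r * c / 3" using n by simp
    finally have "1 \<le> exp (r * c / 3) * exp (- (r * c / (3 * n) * (\<Sum>e\<in>earlier_buckets \<beta> ds. w e)))"
      by (simp flip: exp_add)
    then have "weight_potential r c w ds * 1 \<le> weight_potential r c w ds *
        (exp (r * c / 3) * exp (- (r * c / (3 * n) * (\<Sum>e\<in>earlier_buckets \<beta> ds. w e))))"
      by (intro mult_left_mono) (auto simp: weight_potential_def)
    then show ?thesis by (simp add: G_def mult_ac)
  qed
  then have "(\<integral>\<^sup>+ds. ennreal (weight_potential r c w ds) \<partial>draws \<beta> (l - 1))
      \<le> (\<integral>\<^sup>+ds. ennreal (exp (r * c / 3)) * ennreal (G ds) \<partial>draws \<beta> (l - 1))"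
    by (intro nn_integral_mono_AE)
      (auto simp: AE_measure_pmf_iff ennreal_mult'[symmetric] intro!: ennreal_leI)
  also have "\<dots> = ennreal (exp (r * c / 3)) * (\<integral>\<^sup>+ds. ennreal (G ds) \<partial>draws \<beta> (l - 1))"
    by (rule nn_integral_cmult) simp
  also have "\<dots> \<le> ennreal (exp (r * c / 3)) * 1"
    using draws_potential[OF valid k fin w r c order_refl]
    by (intro mult_left_mono) (auto simp: G_def)
  finally show ?thesis by (simp add: agent_draws_def p)
qed

lemma remaining_subset: "remaining M H \<subseteq> M"
  by (auto simp: remaining_def)

text \<open>The potential is multiplicative under appending, and the bound for one turn holds after
  every possible history because the remaining goods weigh at most \<open>n\<close>. The weights are
  fixed while each agent draws according to her own valuation.\<close>

lemma bucketing_potential: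
  assumes safe: "\<And>i. i < n \<Longrightarrow> follows_safe_strategy n M (v i) \<sigma> i" and n: "n \<ge> 1"
    and fin: "finite M" and w: "\<And>e. e \<in> M \<Longrightarrow> 0 \<le> w e \<and> c * w e \<le> 1" and r: "0 \<le> r" and c: "0 \<le> c"
    and le: "(\<Sum>e\<in>M. w e) \<le> real n" and i: "i \<le> n"
  shows "(\<integral>\<^sup>+H. ennreal (weight_potential r c w (concat H)) \<partial>bucketing \<sigma> i)
    \<le> ennreal (exp (r * c / 3 * i))"
  using i
proof (induction i)
  case 0
  show ?case by (simp add: weight_potential_def)
next
  case (Suc i)
  have append: "ennreal (weight_potential r c w (xs @ ys))
      = ennreal (weight_potential r c w xs) * ennreal (weight_potential r c w ys)" for xs ys
    by (simp add: weight_potential_def powr_add distrib_left ennreal_mult'[symmetric])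
  have step: "(\<integral>\<^sup>+ds. ennreal (weight_potential r c w ds) \<partial>agent_draws (\<sigma> i H))
      \<le> ennreal (exp (r * c / 3))" if H: "H \<in> set_pmf (bucketing \<sigma> i)" for H
  proof (rule agent_draws_potential[OF _ n _ _ r c])
    show "safe_plan n (v i) (remaining M H) (\<sigma> i H)"
      using safe[of i] Suc.prems H by (auto simp: follows_safe_strategy_def)
    show "finite (remaining M H)" by (rule finite_subset[OF remaining_subset fin])
    have "(\<Sum>e\<in>remaining M H. w e) \<le> (\<Sum>e\<in>M. w e)"
      using w fin by (intro sum_mono2 remaining_subset) auto
    with le show "(\<Sum>e\<in>remaining M H. w e) \<le> real n" by simp
    show "0 \<le> w e \<and> c * w e \<le> 1" if "e \<in> remaining M H" for e
      using w subsetD[OF remaining_subset that] by blast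
  qed
  have "(\<integral>\<^sup>+H. ennreal (weight_potential r c w (concat H)) \<partial>bucketing \<sigma> (Suc i))
      = (\<integral>\<^sup>+H. ennreal (weight_potential r c w (concat H)) *
          (\<integral>\<^sup>+ds. ennreal (weight_potential r c w ds) \<partial>agent_draws (\<sigma> i H)) \<partial>bucketing \<sigma> i)"
    by (simp add: append nn_integral_cmult)
  also have "\<dots> \<le> (\<integral>\<^sup>+H. ennreal (weight_potential r c w (concat H)) * ennreal (exp (r * c / 3))
      \<partial>bucketing \<sigma> i)"
    using step by (intro nn_integral_mono_AE) (auto simp: AE_measure_pmf_iff intro!: mult_left_mono)
  also have "\<dots> = (\<integral>\<^sup>+H. ennreal (weight_potential r c w (concat H)) \<partial>bucketing \<sigma> i) *
      ennreal (exp (r * c / 3))"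
    by (rule nn_integral_multc) simp
  also have "\<dots> \<le> ennreal (exp (r * c / 3 * i)) * ennreal (exp (r * c / 3))"
    using Suc by (intro mult_right_mono) auto
  also have "\<dots> = ennreal (exp (r * c / 3 * Suc i))"
    by (simp add: ennreal_mult'[symmetric] mult_exp_exp distrib_left add.commute)
  finally show ?case .
qed

lemma bucketing_removed_weight:
  assumes safe: "\<And>i. i < n \<Longrightarrow> follows_safe_strategy n M (v i) \<sigma> i" and n: "n \<ge> 1"
    and fin: "finite M" and w: "\<And>e. e \<in> M \<Longrightarrow> 0 \<le> w e \<and> w e \<le> 1 / 12"
    and le: "(\<Sum>e\<in>M. w e) \<le> real n"
  shows "measure_pmf.prob (bucketing \<sigma> n) {H. 5 / 12 * n \<le> sum_list (map w (concat H))}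
    \<le> (exp 1 * (4 / 5) ^ 5) ^ n"
proof -
  \<comment> \<open>With \<open>c = 12\<close>, Markov's inequality at weight \<open>5n/12\<close>
    gives \<open>(exp (4 r) / (1 + r)^5)^n\<close>, which is smallest at
    \<open>r = 1/4\<close>.\<close>
  let ?\<Phi> = "\<lambda>H. weight_potential (1/4) 12 w (concat H)"
  have "5 / 12 * n \<le> sum_list (map w (concat H)) \<longleftrightarrow> 1 \<le> ennreal ((4 / 5) ^ (5 * n)) * ennreal (?\<Phi> H)"
    for H
  proof -
    define s where "s = sum_list (map w (concat H))"
    have "(4 / 5 :: real) ^ (5 * n) * ?\<Phi> H = (5 / 4) powr (12 * s - 5 * n)"
    proof -
      have "(4 / 5 :: real) ^ (5 * n) = (5 / 4) powr - real (5 * n)"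
        by (simp add: powr_minus powr_realpow power_inverse[symmetric] del: of_nat_mult)
      then show ?thesis by (simp add: weight_potential_def s_def flip: powr_add)
    qed
    then have "1 \<le> (4 / 5 :: real) ^ (5 * n) * ?\<Phi> H \<longleftrightarrow> 0 \<le> 12 * s - 5 * n"
      using powr_le_cancel_iff[of "5/4::real" 0 "12 * s - 5 * n"] by simp
    also have "\<dots> \<longleftrightarrow> 5 / 12 * real n \<le> s" by auto
    finally show ?thesis
      unfolding s_def[symmetric] by (subst ennreal_mult'[symmetric]) auto
  qed
  then have "emeasure (measure_pmf (bucketing \<sigma> n)) {H. 5 / 12 * n \<le> sum_list (map w (concat H))}
      = emeasure (measure_pmf (bucketing \<sigma> n)) {H. 1 \<le> ennreal ((4 / 5) ^ (5 * n)) * ennreal (?\<Phi> H)}"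
    by simp
  also have "\<dots> \<le> ennreal ((4 / 5) ^ (5 * n)) * (\<integral>\<^sup>+H. ennreal (?\<Phi> H) \<partial>bucketing \<sigma> n)"
    using nn_integral_Markov_inequality[of "\<lambda>H. ennreal (?\<Phi> H)" UNIV "bucketing \<sigma> n"] by simp
  also have "\<dots> \<le> ennreal ((4 / 5) ^ (5 * n)) * ennreal (exp (1 / 4 * 12 / 3 * n))"
    using w by (intro mult_left_mono bucketing_potential[OF safe n fin _ _ _ le]) (auto simp: mult.commute)
  also have "\<dots> = ennreal (exp (real n) * (4 / 5) ^ (5 * n))"
    by (simp add: ennreal_mult'[symmetric] mult.commute)
  also have "exp (real n) = exp 1 ^ n"
    using exp_of_nat_mult[of n "1 :: real"] by simp
  also have "exp 1 ^ n * (4 / 5) ^ (5 * n) = (exp 1 * (4 / 5 :: real) ^ 5) ^ n"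
    by (simp only: power_mult power_mult_distrib)
  finally show ?thesis by (simp add: measure_pmf.emeasure_eq_measure)
qed

section \<open>Failure probability of a single agent\<close>

lemma set_pmf_bucketing:
  assumes "H \<in> set_pmf (bucketing \<sigma> n)"
  shows "length H = n"
    and "i < n \<Longrightarrow> take i H \<in> set_pmf (bucketing \<sigma> i)"
    and "i < n \<Longrightarrow> H ! i \<in> set_pmf (agent_draws (\<sigma> i (take i H)))"
proof -
  have "length H = n \<and> (\<forall>i<n. take i H \<in> set_pmf (bucketing \<sigma> i) \<and>
      H ! i \<in> set_pmf (agent_draws (\<sigma> i (take i H))))"
    using assms
  proof (induction n arbitrary: H)
    case (Suc n)
    then obtain H' ds where *: "H = H' @ [ds]" "H' \<in> set_pmf (bucketing \<sigma> n)"
      "ds \<in> set_pmf (agent_draws (\<sigma> n H'))" by auto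
    from Suc.IH[OF *(2)] * show ?case by (auto simp: less_Suc_eq nth_append)
  qed auto
  then show "length H = n" "i < n \<Longrightarrow> take i H \<in> set_pmf (bucketing \<sigma> i)"
    "i < n \<Longrightarrow> H ! i \<in> set_pmf (agent_draws (\<sigma> i (take i H)))" by auto
qed

lemma bucketing_turn:
  assumes "follows_safe_strategy n M v \<sigma> i" "finite M" "i < n" "H \<in> set_pmf (bucketing \<sigma> n)"
  shows "safe_plan n v (remaining M (take i H)) (\<sigma> i (take i H))"
    and "H ! i \<in> set_pmf (agent_draws (\<sigma> i (take i H)))"
    and "set (H ! i) \<subseteq> M"
proof -
  show safe: "safe_plan n v (remaining M (take i H)) (\<sigma> i (take i H))"
    using assms set_pmf_bucketing(2)[OF assms(4,3)] by (auto simp: follows_safe_strategy_def)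
  show draws: "H ! i \<in> set_pmf (agent_draws (\<sigma> i (take i H)))"
    by (rule set_pmf_bucketing(3)[OF assms(4,3)])
  have "set (H ! i) \<subseteq> remaining M (take i H)"
    using assms(2,3) finite_subset[OF remaining_subset]
    by (intro safe_plan_set_draws[OF safe _ _ draws]) auto
  then show "set (H ! i) \<subseteq> M" by (rule subset_trans[OF _ remaining_subset])
qed

text \<open>Passes from the set of removed goods to the list of draws, whatever repetitions it may
  contain.\<close>

lemma sum_set_le_sum_list:
  fixes w :: "'a \<Rightarrow> real"
  assumes "\<And>x. x \<in> set xs \<Longrightarrow> 0 \<le> w x"
  shows "sum w (set xs) \<le> sum_list (map w xs)"
  using assms
proof (induction xs)
  case (Cons x xs)
  then have "sum w (set (x # xs)) \<le> w x + sum w (set xs)"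
    by (simp add: sum.insert_if)
  with Cons show ?case by simp
qed simp

lemma bucketing_failure_prob:
  assumes safe: "\<And>i. i < n \<Longrightarrow> follows_safe_strategy n M (v i) \<sigma> i" and n: "n \<ge> 1"
    and fin: "finite M" and i: "i < n"
    and sub: "submodular_on M (v i)" and mono: "mono_on (Pow M) (v i)"
    and nonneg: "0 \<le> v i {}" and mms: "mms n M (v i) = 1"
    and small: "\<And>e. e \<in> M \<Longrightarrow> v i {e} \<le> 1 / 12"
  shows "measure_pmf.prob (bucketing \<sigma> n) {H. \<not> 1 / 12 \<le> v i (allocated H i)}
    \<le> (exp 1 * (4 / 5) ^ 5) ^ n"
proof -
  obtain P where P: "P \<in> bundle_partitions n M" and ge: "\<And>l. l < n \<Longrightarrow> 1 \<le> v i (P l)"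
    using mms_attained[OF n fin, of "v i"] mms by auto
  note turn = bucketing_turn[OF safe[OF i] fin i]
  show ?thesis
  proof (cases "v i {} < 1")
    \<comment> \<open>Normalizing the weights needs \<open>v i {} < 1\<close>; otherwise
      monotonicity alone rules out failure.\<close>
    case False
    have "1 / 12 \<le> v i (allocated H i)" if "H \<in> set_pmf (bucketing \<sigma> n)" for H
    proof -
      have "v i {} \<le> v i (allocated H i)"
        using turn(3)[OF that] by (intro mono_onD[OF mono]) (auto simp: allocated_def)
      with False show ?thesis by simp
    qed
    then have "measure_pmf.prob (bucketing \<sigma> n) {H. \<not> 1 / 12 \<le> v i (allocated H i)} = 0"
      by (auto simp: measure_pmf_zero_iff)
    then show ?thesis by simp
  next
    case True
    obtain w where w: "\<And>e. e \<in> M \<Longrightarrow> 0 \<le> w e \<and> w e \<le> 1 / 12" "(\<Sum>e\<in>M. w e) = real n"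
      "\<And>R. R \<subseteq> M \<Longrightarrow> (\<Sum>e\<in>R. w e) \<le> (\<Sum>l<n. v i (P l \<inter> R))"
      using partition_weights[OF sub mono fin nonneg True small _ P ge] by auto
    have "5 / 12 * n \<le> sum_list (map w (concat H))"
      if H: "H \<in> set_pmf (bucketing \<sigma> n)" and bad: "\<not> 1 / 12 \<le> v i (allocated H i)" for H
    proof -
      define R where "R = remaining M (take i H)"
      have R: "R \<subseteq> M" by (simp add: R_def remaining_subset)
      have HM: "set (concat H) \<subseteq> M"
        using bucketing_turn(3)[OF safe fin _ H] set_pmf_bucketing(1)[OF H]
        by (fastforce simp: in_set_conv_nth)
      have "(\<Sum>e\<in>R. w e) \<le> real n * (3 * (1 / 12) + 4 * v i (set (H ! i)))"
      proof (rule order_trans[OF w(3)[OF R] safe_plan_value_ge[OF sub mono fin nonneg small _ n R]])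
        show "safe_plan n (v i) R (\<sigma> i (take i H))" unfolding R_def by (rule turn(1)[OF H])
      qed (use turn(2)[OF H] P in auto)
      \<comment> \<open>Here \<open>3/12 + 4/12 = 7/12\<close>, so goods of weight at least
        \<open>5n/12\<close> are missing from \<open>R\<close>.\<close>
      also have "\<dots> \<le> real n * (7 / 12)"
        using bad by (intro mult_left_mono) (auto simp: allocated_def)
      finally have "(\<Sum>e\<in>R. w e) \<le> 7 / 12 * n" by simp
      moreover have "(\<Sum>e\<in>M. w e) = (\<Sum>e\<in>M - R. w e) + (\<Sum>e\<in>R. w e)"
        by (rule sum.subset_diff[OF R fin])
      \<comment> \<open>Only draws before turn \<open>i\<close> are missing from \<open>R\<close>;
        counting the later ones too gives an event about the complete history.\<close>
      moreover have "(\<Sum>e\<in>M - R. w e) \<le> (\<Sum>e\<in>set (concat H). w e)"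
        using HM w(1) by (intro sum_mono2) (auto simp: R_def remaining_def dest: in_set_takeD)
      moreover have "\<dots> \<le> sum_list (map w (concat H))"
        using HM w(1) by (intro sum_set_le_sum_list) auto
      ultimately show ?thesis using w(2) by simp
    qed
    then have "measure_pmf.prob (bucketing \<sigma> n) {H. \<not> 1 / 12 \<le> v i (allocated H i)}
        \<le> measure_pmf.prob (bucketing \<sigma> n) {H. 5 / 12 * n \<le> sum_list (map w (concat H))}"
      by (intro measure_pmf.finite_measure_mono_AE) (auto simp: AE_measure_pmf_iff)
    also have "\<dots> \<le> (exp 1 * (4 / 5) ^ 5) ^ n"
      using bucketing_removed_weight[where v = v, OF safe n fin w(1)] w(2) by simp
    finally show ?thesis .
  qed
qed

section \<open>Union bound over the agents\<close>

text \<open>The base is below 1 because \<open>exp 1 \<le> 3\<close> and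
  \<open>3 * (4/5)^5 < 1\<close>, so geometric decay beats the factor \<open>n\<close>.\<close>

lemma union_bound_summand:
  "\<exists>C>0. \<forall>n\<ge>1. real n * (exp 1 * (4 / 5) ^ 5) ^ n \<le> C * real n powr - 1"
proof -
  define q :: real where "q = exp 1 * (4 / 5) ^ 5"
  have "exp 1 * (4 / 5 :: real) ^ 5 \<le> 3 * (4 / 5) ^ 5"
    using exp_le by (intro mult_right_mono) auto
  also have "\<dots> < 1" by (simp add: power_divide)
  finally have q: "0 < q" "q < 1" by (auto simp: q_def)
  \<comment> \<open>The square root is taken because the claim amounts to bounding
    \<open>n^2 * q^n\<close>, the square of this sequence.\<close>
  have "(\<lambda>n. real n * sqrt q ^ n) \<longlonglongrightarrow> 0"
    using q by (intro powser_times_n_limit_0) auto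
  then have "Bseq (\<lambda>n. real n * sqrt q ^ n)"
    by (intro convergent_imp_Bseq convergentI)
  then obtain K where K: "K > 0" "\<And>n. norm (real n * sqrt q ^ n) \<le> K"
    by (auto elim: BseqE)
  have "real n * q ^ n \<le> K\<^sup>2 * real n powr - 1" if n: "n \<ge> 1" for n
  proof -
    have "(real n * sqrt q ^ n)\<^sup>2 \<le> K\<^sup>2"
      using K(2)[of n] q by (intro power_mono) auto
    moreover have "(sqrt q ^ n)\<^sup>2 = (sqrt q ^ 2) ^ n"
      by (simp add: mult.commute flip: power_mult)
    then have "(real n * sqrt q ^ n)\<^sup>2 = real n * (real n * q ^ n)"
      using q by (simp add: power_mult_distrib power2_eq_square)
    ultimately show ?thesis
      using n by (simp add: powr_minus field_simps)
  qed
  with K(1) show ?thesis unfolding q_def by (intro exI[of _ "K\<^sup>2"]) auto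
qed

theorem theorem4p6:
  "\<exists>(\<delta> :: nat \<Rightarrow> real) (C :: real) (a :: real).
     \<delta> \<longlonglongrightarrow> 0 \<and> C > 0 \<and> a > 0 \<and>
     (\<forall>(n :: nat) (m :: nat) (v :: nat \<Rightarrow> nat set \<Rightarrow> real) (\<sigma> :: nat strategies).
        n \<ge> 1 \<longrightarrow>
        (\<forall>i<n. (\<forall>S\<subseteq>{..<m}. v i S \<ge> 0) \<and>
                mono_on (Pow {..<m}) (v i) \<and>
                submodular_on {..<m} (v i) \<and>
                mms n {..<m} (v i) = 1 \<and>
                (\<forall>e<m. v i {e} \<le> 1 / 12)) \<longrightarrow>
        (\<forall>i<n. follows_safe_strategy n {..<m} (v i) \<sigma> i) \<longrightarrow>
        measure_pmf.prob (bucketing \<sigma> n)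
          {H. \<forall>i<n. v i (allocated H i) \<ge> (1 / 12 - \<delta> n) * mms n {..<m} (v i)}
        \<ge> 1 - C * real n powr (- a))"
proof -
  obtain C :: real where C: "C > 0"
    "\<And>n. n \<ge> 1 \<Longrightarrow> real n * (exp 1 * (4 / 5) ^ 5) ^ n \<le> C * real n powr - 1"
    using union_bound_summand by blast
  have prob_good: "1 - C * real n powr - 1 \<le> measure_pmf.prob (bucketing \<sigma> n)
      {H. \<forall>i<n. v i (allocated H i) \<ge> (1 / 12 - 0) * mms n {..<m} (v i)}"
    if n: "n \<ge> 1"
      and v: "\<And>i. i < n \<Longrightarrow> (\<forall>S\<subseteq>{..<m}. v i S \<ge> 0) \<and> mono_on (Pow {..<m}) (v i) \<and>
        submodular_on {..<m} (v i) \<and> mms n {..<m} (v i) = 1 \<and> (\<forall>e<m. v i {e} \<le> 1 / 12)"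
      and safe: "\<And>i. i < n \<Longrightarrow> follows_safe_strategy n {..<m} (v i) \<sigma> i"
    for n m :: nat and v :: "nat \<Rightarrow> nat set \<Rightarrow> real" and \<sigma> :: "nat strategies"
  proof -
    define good where "good = {H :: nat history. \<forall>i<n. 1 / 12 \<le> v i (allocated H i)}"
    let ?bad = "\<lambda>i. {H :: nat history. \<not> 1 / 12 \<le> v i (allocated H i)}"
    have "measure_pmf.prob (bucketing \<sigma> n) (UNIV - good)
        \<le> measure_pmf.prob (bucketing \<sigma> n) (\<Union>i<n. ?bad i)"
      by (intro measure_pmf.finite_measure_mono) (auto simp: good_def)
    also have "\<dots> \<le> (\<Sum>i<n. measure_pmf.prob (bucketing \<sigma> n) (?bad i))"
      by (intro measure_pmf.finite_measure_subadditive_finite) auto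
    also have "\<dots> \<le> (\<Sum>i<n. (exp 1 * (4 / 5) ^ 5) ^ n)"
    proof (intro sum_mono)
      fix i assume "i \<in> {..<n}"
      then have i: "i < n" by simp
      show "measure_pmf.prob (bucketing \<sigma> n) (?bad i) \<le> (exp 1 * (4 / 5) ^ 5) ^ n"
        using v[OF i] by (intro bucketing_failure_prob[OF safe n _ i]) auto
    qed
    also have "\<dots> \<le> C * real n powr - 1" using C(2)[OF n] by simp
    finally have "1 - C * real n powr - 1 \<le> measure_pmf.prob (bucketing \<sigma> n) good"
      using measure_pmf.prob_compl[of good "bucketing \<sigma> n"] by simp
    also have "good = {H. \<forall>i<n. v i (allocated H i) \<ge> (1 / 12 - 0) * mms n {..<m} (v i)}"
      using v by (auto simp: good_def)
    finally show ?thesis .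
  qed
  \<comment> \<open>No loss occurs in the ratio: \<open>\<delta>\<close> is identically 0, and the
    exponent is \<open>a = 1\<close>.\<close>
  show ?thesis
    by (rule exI[of _ "\<lambda>_. 0"], rule exI[of _ C], rule exI[of _ 1])
      (use C(1) prob_good in \<open>simp only: tendsto_const zero_less_one simp_thms, blast\<close>)
qed

end
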